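(* Let $\Bbbk$ be a field, $(A,\Delta)$ a cocommutative $\Bbbk$-algebra, $V$ an $A$-module, and $\kappa_A:V\wedge V\to A$ a $\Bbbk$-linear map (so $\kappa_V\equiv0$). Consider the Jacobi identity, required to hold in $V\otimes A$ for all $v_1,v_2,v_3\in V$ ($\sum_\circlearrowright$ being the sum over cyclic permutations): $$(\mathrm{J})\qquad\sum_\circlearrowright v_1\otimes\kappa_A(v_2,v_3)=\sum_\circlearrowright\kappa_A(v_1,v_2)_{(1)}(v_3)\otimes\kappa_A(v_1,v_2)_{(2)}.$$ (1) Suppose $A$ contains a grouplike element $T_m$ and a vector space complement $V_0$ to $\Bbbk T_m$ such that $\Delta(V_0)\subset V_0\otimes V_0$. Extend $T_m$ by any basis of $V_0$ to a basis of $A$, and let $\kappa_m$ be the coefficient of $T_m$ in $\kappa_A$ with respect to this basis. If (J) holds, then one of the following conditions holds: (a) $\kappa_m\equiv0$. (b) $T_m$ acts as $\mathrm{id}_V$ on $V$, i.e. $d_m=0$. (c) $d_m$ is $1$ or $2$, and $\operatorname{Rad}(\kappa_m)$ is a subspace of $\operatorname{Fix}(T_m)$ of codimension $2-d_m$ (in $\operatorname{Fix}(T_m)$). (2) Conversely, if $A$ is a grouplike algebra with distinguished $\Bbbk$-basis $\{T_m:m\in M_A\}$ of grouplike elements, and for each $m\in M_A$ one of the conditions (a), (b), (c) holds, then (J) holds.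
   Context: A cocommutative $\Bbbk$-algebra $(A,\Delta)$ is a unital associative $\Bbbk$-algebra $A$ with a $\Bbbk$-algebra map $\Delta:A\to A\otimes A$ satisfying $\Delta(1)=1\otimes1$, coassociativity, and $\Delta=\Delta^{op}$ (no counit or antipode is assumed). Sweedler notation: $\Delta(a)=\sum a_{(1)}\otimes a_{(2)}$. An element $g\in A$ is grouplike if $\Delta(g)=g\otimes g$; here $T_m$ is nonzero, being part of a basis. A grouplike algebra is a unital $\Bbbk$-algebra $A$ with a distinguished $\Bbbk$-basis $\{T_m:m\in M_A\}$ containing $1_A$ such that $T_m\mapsto T_m\otimes T_m$ extends linearly to an algebra map $\Delta:A\to A\otimes A$ (this is its cocommutative coproduct). $V\wedge V\subset V\otimes V$ is the span of the $v\wedge v'=v\otimes v'-v'\otimes v$; $\kappa_A(v,v')=\kappa_A(v\wedge v')$. Given a basis $\{a_j\}$ of $A$, write $\kappa_A(x,y)=\sum_j\kappa_j(x,y)a_j$; each $\kappa_j$ is an alternating bilinear form on $V$, and for $a_j=T_m$ write $\kappa_m$. $\operatorname{Rad}(\kappa_m):=\{v\in V:\kappa_m(v,V)=0\}$; $\operatorname{Fix}(T_m):=\{v\in V:T_m(v)=v\}$; $d_m:=\operatorname{codim}_V\operatorname{Fix}(T_m)=\dim\operatorname{im}(\mathrm{id}_V-T_m)$. *)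

theory Defs
  imports "HOL-Library.Poly_Mapping" "HOL-Library.Extended_Nat"
begin

text \<open>
  Vector spaces over a field \<open>'k\<close> are given by a type together with a scalar multiplication
  satisfying the library predicate \<open>vector_space\<close>; they may be infinite-dimensional.
\<close>

section \<open>Tensor products\<close>

text \<open>
  \<open>'x \<Rightarrow>\<^sub>0 'k\<close> is the vector space with basis \<open>'x\<close>; the basis vector of \<open>x\<close> is \<open>gen x\<close>.
\<close>

definition free_scale :: "'k::field \<Rightarrow> ('x \<Rightarrow>\<^sub>0 'k) \<Rightarrow> ('x \<Rightarrow>\<^sub>0 'k)" where
  "free_scale c x = Poly_Mapping.map ((*) c) x"

definition gen :: "'x \<Rightarrow> ('x \<Rightarrow>\<^sub>0 'k::field)" where
  "gen x = Poly_Mapping.single x 1"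

text \<open>The linear map determined by \<open>gen x \<mapsto> f x\<close>.\<close>

definition free_extend :: "('x \<Rightarrow> ('y \<Rightarrow>\<^sub>0 'k)) \<Rightarrow> ('x \<Rightarrow>\<^sub>0 'k) \<Rightarrow> ('y \<Rightarrow>\<^sub>0 'k::field)" where
  "free_extend f x = (\<Sum>p\<in>Poly_Mapping.keys x. free_scale (Poly_Mapping.lookup x p) (f p))"

text \<open>
  \<open>U \<otimes> W\<close> is the free vector space on \<open>U \<times> W\<close> modulo the bilinearity relations; its elements are
  the cosets \<open>tensor_class sU sW x\<close>. The scalar multiplications are those of \<open>U\<close> and \<open>W\<close>.
\<close>

type_synonym ('k, 'u, 'w) tensor = "('u \<times> 'w \<Rightarrow>\<^sub>0 'k) set"

definition tensor_relations ::
  "('k::field \<Rightarrow> 'u::ab_group_add \<Rightarrow> 'u) \<Rightarrow> ('k \<Rightarrow> 'w::ab_group_add \<Rightarrow> 'w) \<Rightarrow>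
   ('u \<times> 'w \<Rightarrow>\<^sub>0 'k) set" where
  "tensor_relations sU sW = module.span free_scale
     ({gen (u + u', w) - gen (u, w) - gen (u', w) | u u' w. True} \<union>
      {gen (u, w + w') - gen (u, w) - gen (u, w') | u w w'. True} \<union>
      {gen (sU c u, w) - free_scale c (gen (u, w)) | c u w. True} \<union>
      {gen (u, sW c w) - free_scale c (gen (u, w)) | c u w. True})"

definition tensor_class ::
  "('k::field \<Rightarrow> 'u::ab_group_add \<Rightarrow> 'u) \<Rightarrow> ('k \<Rightarrow> 'w::ab_group_add \<Rightarrow> 'w) \<Rightarrow>
   ('u \<times> 'w \<Rightarrow>\<^sub>0 'k) \<Rightarrow> ('k, 'u, 'w) tensor" where
  "tensor_class sU sW x = {y. y - x \<in> tensor_relations sU sW}"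

definition tensor_space ::
  "('k::field \<Rightarrow> 'u::ab_group_add \<Rightarrow> 'u) \<Rightarrow> ('k \<Rightarrow> 'w::ab_group_add \<Rightarrow> 'w) \<Rightarrow>
   ('k, 'u, 'w) tensor set" where
  "tensor_space sU sW = {tensor_class sU sW x | x. True}"

definition pure_tensor ::
  "('k::field \<Rightarrow> 'u::ab_group_add \<Rightarrow> 'u) \<Rightarrow> ('k \<Rightarrow> 'w::ab_group_add \<Rightarrow> 'w) \<Rightarrow>
   'u \<Rightarrow> 'w \<Rightarrow> ('k, 'u, 'w) tensor" where
  "pure_tensor sU sW u w = tensor_class sU sW (gen (u, w))"

text \<open>
  The image of \<open>U\<^sub>0 \<otimes> W\<^sub>0\<close> in \<open>U \<otimes> W\<close>, for subspaces \<open>U\<^sub>0\<close> and \<open>W\<^sub>0\<close>.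
\<close>

definition subtensor ::
  "('k::field \<Rightarrow> 'u::ab_group_add \<Rightarrow> 'u) \<Rightarrow> ('k \<Rightarrow> 'w::ab_group_add \<Rightarrow> 'w) \<Rightarrow>
   'u set \<Rightarrow> 'w set \<Rightarrow> ('k, 'u, 'w) tensor set" where
  "subtensor sU sW U0 W0 = {tensor_class sU sW x | x. Poly_Mapping.keys x \<subseteq> U0 \<times> W0}"

text \<open>
  A representing formal sum of a tensor, as in Sweedler notation. The operations below respect the
  tensor relations (when \<open>\<Delta>\<close> and the action are linear), so the resulting classes do not depend on
  this choice.
\<close>

definition rep :: "('k::field, 'u, 'w) tensor \<Rightarrow> ('u \<times> 'w \<Rightarrow>\<^sub>0 'k)" where
  "rep X = (SOME x. x \<in> X)"

definition tensor_add ::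
  "('k::field \<Rightarrow> 'u::ab_group_add \<Rightarrow> 'u) \<Rightarrow> ('k \<Rightarrow> 'w::ab_group_add \<Rightarrow> 'w) \<Rightarrow>
   ('k, 'u, 'w) tensor \<Rightarrow> ('k, 'u, 'w) tensor \<Rightarrow> ('k, 'u, 'w) tensor" where
  "tensor_add sU sW X Y = tensor_class sU sW (rep X + rep Y)"

definition tensor_scale ::
  "('k::field \<Rightarrow> 'u::ab_group_add \<Rightarrow> 'u) \<Rightarrow> ('k \<Rightarrow> 'w::ab_group_add \<Rightarrow> 'w) \<Rightarrow>
   'k \<Rightarrow> ('k, 'u, 'w) tensor \<Rightarrow> ('k, 'u, 'w) tensor" where
  "tensor_scale sU sW c X = tensor_class sU sW (free_scale c (rep X))"

text \<open>The product \<open>(a \<otimes> b)(c \<otimes> d) = ac \<otimes> bd\<close> and the flip \<open>a \<otimes> b \<mapsto> b \<otimes> a\<close> on \<open>A \<otimes> A\<close>.\<close>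

definition tensor_mult ::
  "('k::field \<Rightarrow> 'a::ring_1 \<Rightarrow> 'a) \<Rightarrow>
   ('k, 'a, 'a) tensor \<Rightarrow> ('k, 'a, 'a) tensor \<Rightarrow> ('k, 'a, 'a) tensor" where
  "tensor_mult sA X Y = tensor_class sA sA
     (free_extend (\<lambda>(a, b). free_extend (\<lambda>(c, d). gen (a * c, b * d)) (rep Y)) (rep X))"

definition tensor_flip ::
  "('k::field \<Rightarrow> 'a::ab_group_add \<Rightarrow> 'a) \<Rightarrow> ('k, 'a, 'a) tensor \<Rightarrow> ('k, 'a, 'a) tensor" where
  "tensor_flip sA X = tensor_class sA sA (free_extend (\<lambda>(a, b). gen (b, a)) (rep X))"

text \<open>
  \<open>A \<otimes> A \<otimes> A\<close>, as the free vector space on \<open>A \<times> A \<times> A\<close> modulo the trilinearity relations.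
\<close>

definition tensor3_relations ::
  "('k::field \<Rightarrow> 'a::ab_group_add \<Rightarrow> 'a) \<Rightarrow> ('a \<times> 'a \<times> 'a \<Rightarrow>\<^sub>0 'k) set" where
  "tensor3_relations sA = module.span free_scale
     ({gen (a + a', b, c) - gen (a, b, c) - gen (a', b, c) | a a' b c. True} \<union>
      {gen (a, b + b', c) - gen (a, b, c) - gen (a, b', c) | a b b' c. True} \<union>
      {gen (a, b, c + c') - gen (a, b, c) - gen (a, b, c') | a b c c'. True} \<union>
      {gen (sA r a, b, c) - free_scale r (gen (a, b, c)) | r a b c. True} \<union>
      {gen (a, sA r b, c) - free_scale r (gen (a, b, c)) | r a b c. True} \<union>
      {gen (a, b, sA r c) - free_scale r (gen (a, b, c)) | r a b c. True})"

definition tensor3_class ::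
  "('k::field \<Rightarrow> 'a::ab_group_add \<Rightarrow> 'a) \<Rightarrow> ('a \<times> 'a \<times> 'a \<Rightarrow>\<^sub>0 'k) \<Rightarrow>
   ('a \<times> 'a \<times> 'a \<Rightarrow>\<^sub>0 'k) set" where
  "tensor3_class sA x = {y. y - x \<in> tensor3_relations sA}"

text \<open>\<open>\<Delta> \<otimes> id\<close> and \<open>id \<otimes> \<Delta>\<close>, from \<open>A \<otimes> A\<close> to \<open>A \<otimes> A \<otimes> A\<close>.\<close>

definition coproduct_left ::
  "('k::field \<Rightarrow> 'a::ab_group_add \<Rightarrow> 'a) \<Rightarrow> ('a \<Rightarrow> ('k, 'a, 'a) tensor) \<Rightarrow>
   ('k, 'a, 'a) tensor \<Rightarrow> ('a \<times> 'a \<times> 'a \<Rightarrow>\<^sub>0 'k) set" where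
  "coproduct_left sA \<Delta> X = tensor3_class sA
     (free_extend (\<lambda>(a, b). free_extend (\<lambda>(p, q). gen (p, q, b)) (rep (\<Delta> a))) (rep X))"

definition coproduct_right ::
  "('k::field \<Rightarrow> 'a::ab_group_add \<Rightarrow> 'a) \<Rightarrow> ('a \<Rightarrow> ('k, 'a, 'a) tensor) \<Rightarrow>
   ('k, 'a, 'a) tensor \<Rightarrow> ('a \<times> 'a \<times> 'a \<Rightarrow>\<^sub>0 'k) set" where
  "coproduct_right sA \<Delta> X = tensor3_class sA
     (free_extend (\<lambda>(a, b). free_extend (\<lambda>(p, q). gen (a, p, q)) (rep (\<Delta> b))) (rep X))"


section \<open>Cocommutative algebras, grouplike algebras and modules\<close>

locale k_algebra = vector_space sA
  for sA :: "'k::field \<Rightarrow> 'a::ring_1 \<Rightarrow> 'a" +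
  assumes scale_mult_left: "sA c a * b = sA c (a * b)"
    and scale_mult_right: "a * sA c b = sA c (a * b)"

text \<open>\<open>\<Delta>\<close> is a homomorphism of unital algebras from \<open>A\<close> to \<open>A \<otimes> A\<close>.\<close>

locale algebra_coproduct = k_algebra sA
  for sA :: "'k::field \<Rightarrow> 'a::ring_1 \<Rightarrow> 'a" +
  fixes \<Delta> :: "'a \<Rightarrow> ('k, 'a, 'a) tensor"
  assumes coproduct_in: "\<Delta> a \<in> tensor_space sA sA"
    and coproduct_add: "\<Delta> (a + b) = tensor_add sA sA (\<Delta> a) (\<Delta> b)"
    and coproduct_scale: "\<Delta> (sA c a) = tensor_scale sA sA c (\<Delta> a)"
    and coproduct_mult: "\<Delta> (a * b) = tensor_mult sA (\<Delta> a) (\<Delta> b)"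
    and coproduct_one: "\<Delta> 1 = pure_tensor sA sA 1 1"

locale cocommutative_algebra = algebra_coproduct +
  assumes coassociative: "coproduct_left sA \<Delta> (\<Delta> a) = coproduct_right sA \<Delta> (\<Delta> a)"
    and cocommutative: "tensor_flip sA (\<Delta> a) = \<Delta> a"

text \<open>\<open>G\<close> is the distinguished basis \<open>{T\<^sub>m | m \<in> M\<^sub>A}\<close>.\<close>

locale grouplike_algebra = algebra_coproduct +
  fixes G
  assumes basis_independent: "\<not> module.dependent sA G"
    and basis_span: "module.span sA G = UNIV"
    and basis_one: "1 \<in> G"
    and coproduct_basis: "T \<in> G \<Longrightarrow> \<Delta> T = pure_tensor sA sA T T"

definition grouplike ::
  "('k::field \<Rightarrow> 'a::ring_1 \<Rightarrow> 'a) \<Rightarrow> ('a \<Rightarrow> ('k, 'a, 'a) tensor) \<Rightarrow> 'a \<Rightarrow> bool" where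
  "grouplike sA \<Delta> g \<longleftrightarrow> g \<noteq> 0 \<and> \<Delta> g = pure_tensor sA sA g g"

locale algebra_module = A: k_algebra sA + V: vector_space sV
  for sA :: "'k::field \<Rightarrow> 'a::ring_1 \<Rightarrow> 'a"
    and sV :: "'k \<Rightarrow> 'v::ab_group_add \<Rightarrow> 'v" +
  fixes act :: "'a \<Rightarrow> 'v \<Rightarrow> 'v"
  assumes act_add_right: "act a (v + w) = act a v + act a w"
    and act_add_left: "act (a + b) v = act a v + act b v"
    and act_scale: "act (sA c a) v = sV c (act a v)"
    and act_mult: "act (a * b) v = act a (act b v)"
    and act_one: "act 1 v = v"


section \<open>The parameter map and the Jacobi identity\<close>

definition wedge ::
  "('k::field \<Rightarrow> 'v::ab_group_add \<Rightarrow> 'v) \<Rightarrow> 'v \<Rightarrow> 'v \<Rightarrow> ('k, 'v, 'v) tensor" where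
  "wedge sV v w = tensor_class sV sV (gen (v, w) - gen (w, v))"

text \<open>\<open>V \<and> V\<close> as a subspace of \<open>V \<otimes> V\<close>: the classes of linear combinations of \<open>v \<otimes> w - w \<otimes> v\<close>.\<close>

definition wedge_space ::
  "('k::field \<Rightarrow> 'v::ab_group_add \<Rightarrow> 'v) \<Rightarrow> ('k, 'v, 'v) tensor set" where
  "wedge_space sV = tensor_class sV sV `
     module.span free_scale {gen (v, w) - gen (w, v) | v w. True}"

definition wedge_linear ::
  "('k::field \<Rightarrow> 'v::ab_group_add \<Rightarrow> 'v) \<Rightarrow> ('k \<Rightarrow> 'a::ab_group_add \<Rightarrow> 'a) \<Rightarrow>
   (('k, 'v, 'v) tensor \<Rightarrow> 'a) \<Rightarrow> bool" where
  "wedge_linear sV sA \<kappa> \<longleftrightarrow>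
     (\<forall>X\<in>wedge_space sV. \<forall>Y\<in>wedge_space sV. \<kappa> (tensor_add sV sV X Y) = \<kappa> X + \<kappa> Y) \<and>
     (\<forall>c. \<forall>X\<in>wedge_space sV. \<kappa> (tensor_scale sV sV c X) = sA c (\<kappa> X))"

text \<open>
  The formal sum \<open>a\<^sub>(\<^sub>1\<^sub>)(v) \<otimes> a\<^sub>(\<^sub>2\<^sub>)\<close> representing an element of \<open>V \<otimes> A\<close>.
\<close>

definition coproduct_act ::
  "('a \<Rightarrow> 'v \<Rightarrow> 'v) \<Rightarrow> ('a \<Rightarrow> ('k::field, 'a, 'a) tensor) \<Rightarrow> 'a \<Rightarrow> 'v \<Rightarrow> ('v \<times> 'a \<Rightarrow>\<^sub>0 'k)" where
  "coproduct_act act \<Delta> a v = free_extend (\<lambda>(p, q). gen (act p v, q)) (rep (\<Delta> a))"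

definition jacobi ::
  "('k::field \<Rightarrow> 'a::ring_1 \<Rightarrow> 'a) \<Rightarrow> ('k \<Rightarrow> 'v::ab_group_add \<Rightarrow> 'v) \<Rightarrow> ('a \<Rightarrow> 'v \<Rightarrow> 'v) \<Rightarrow>
   ('a \<Rightarrow> ('k, 'a, 'a) tensor) \<Rightarrow> (('k, 'v, 'v) tensor \<Rightarrow> 'a) \<Rightarrow> bool" where
  "jacobi sA sV act \<Delta> \<kappa> \<longleftrightarrow>
     (\<forall>v1 v2 v3.
        tensor_class sV sA
          (gen (v1, \<kappa> (wedge sV v2 v3)) + gen (v2, \<kappa> (wedge sV v3 v1)) + gen (v3, \<kappa> (wedge sV v1 v2)))
      = tensor_class sV sA
          (coproduct_act act \<Delta> (\<kappa> (wedge sV v1 v2)) v3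
           + coproduct_act act \<Delta> (\<kappa> (wedge sV v2 v3)) v1
           + coproduct_act act \<Delta> (\<kappa> (wedge sV v3 v1)) v2))"

text \<open>\<open>\<kappa>\<^sub>m(v, w)\<close>, the coefficient of the basis element \<open>T\<close> in \<open>\<kappa>(v \<and> w)\<close> with respect to the basis \<open>B\<close>.\<close>

definition kappa_coeff ::
  "('k::field \<Rightarrow> 'a::ring_1 \<Rightarrow> 'a) \<Rightarrow> ('k \<Rightarrow> 'v::ab_group_add \<Rightarrow> 'v) \<Rightarrow>
   (('k, 'v, 'v) tensor \<Rightarrow> 'a) \<Rightarrow> 'a set \<Rightarrow> 'a \<Rightarrow> 'v \<Rightarrow> 'v \<Rightarrow> 'k" where
  "kappa_coeff sA sV \<kappa> B T v w = module.representation sA B (\<kappa> (wedge sV v w)) T"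


section \<open>Complements, codimension and the three conditions\<close>

definition complementary ::
  "('k::field \<Rightarrow> 'v::ab_group_add \<Rightarrow> 'v) \<Rightarrow> 'v set \<Rightarrow> 'v set \<Rightarrow> 'v set \<Rightarrow> bool" where
  "complementary s U U' W \<longleftrightarrow>
     module.subspace s U \<and> module.subspace s U' \<and> U \<inter> U' = {0} \<and> {u + u' | u u'. u \<in> U \<and> u' \<in> U'} = W"

text \<open>
  The codimension of \<open>U\<close> in \<open>W\<close> is the dimension of \<open>W / U\<close>. A set \<open>B\<close> as below is a basis
  of a complement of \<open>U\<close> in \<open>W\<close>, i.e. it maps bijectively onto a basis of \<open>W / U\<close>; hence the
  value does not depend on \<open>B\<close>. The library function \<open>dim\<close> is avoided because it is \<open>0\<close> on
  infinite-dimensional subspaces.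
\<close>

definition codim ::
  "('k::field \<Rightarrow> 'v::ab_group_add \<Rightarrow> 'v) \<Rightarrow> 'v set \<Rightarrow> 'v set \<Rightarrow> enat" where
  "codim s U W =
     (let basis = (\<lambda>B. finite B \<and> \<not> module.dependent s B \<and> complementary s U (module.span s B) W)
      in if \<exists>B. basis B then enat (card (SOME B. basis B)) else \<infinity>)"

definition Rad :: "('v \<Rightarrow> 'v \<Rightarrow> 'k::zero) \<Rightarrow> 'v set" where
  "Rad \<beta> = {v. \<forall>w. \<beta> v w = 0}"

definition Fix :: "('v \<Rightarrow> 'v) \<Rightarrow> 'v set" where
  "Fix t = {v. t v = v}"

text \<open>
  The alternatives (a), (b), (c) for the form \<open>\<beta> = \<kappa>\<^sub>m\<close> and the action \<open>t\<close> of \<open>T\<^sub>m\<close> on \<open>V\<close>,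
  with \<open>d\<^sub>m = codim s (Fix t) UNIV\<close>.
\<close>

definition reflection_condition ::
  "('k::field \<Rightarrow> 'v::ab_group_add \<Rightarrow> 'v) \<Rightarrow> ('v \<Rightarrow> 'v) \<Rightarrow> ('v \<Rightarrow> 'v \<Rightarrow> 'k) \<Rightarrow> bool" where
  "reflection_condition s t \<beta> \<longleftrightarrow>
     (\<forall>v w. \<beta> v w = 0) \<or>
     (\<forall>v. t v = v) \<or>
     ((codim s (Fix t) UNIV = 1 \<or> codim s (Fix t) UNIV = 2) \<and>
      Rad \<beta> \<subseteq> Fix t \<and>
      codim s (Rad \<beta>) (Fix t) = 2 - codim s (Fix t) UNIV)"

end

theory Submission
  imports Defs
begin

text \<open>
  Apply \<open>id \<otimes> T\<^sup>*\<close> to the Jacobi identity, where \<open>T\<^sup>*\<close> is the coordinate form of the grouplike element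
  \<open>T\<close> in a basis \<open>B\<close>. The coproduct sends \<open>T\<close> to \<open>T \<otimes> T\<close> and the remaining basis vectors to tensors
  whose second factors have no \<open>T\<close>-component, so \<open>a\<^sub>(\<^sub>1\<^sub>)(v) \<otimes> a\<^sub>(\<^sub>2\<^sub>)\<close> becomes \<open>T\<^sup>*(a) T(v)\<close>
  (\<open>slice_coproduct_act\<close>). With \<open>\<beta>\<close> for the \<open>T\<close>-coefficient of the parameter map and \<open>t\<close> for the
  action of \<open>T\<close>, the Jacobi identity therefore implies the cyclic identity in \<open>V\<close>

  \<open>\<beta>(v\<^sub>2, v\<^sub>3) (v\<^sub>1 - t v\<^sub>1) + \<beta>(v\<^sub>3, v\<^sub>1) (v\<^sub>2 - t v\<^sub>2) + \<beta>(v\<^sub>1, v\<^sub>2) (v\<^sub>3 - t v\<^sub>3) = 0\<close>.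

  If the whole basis is grouplike, this can be done for each of its elements, and since an element of
  \<open>V \<otimes> A\<close> is zero when all its coordinates in \<open>V\<close> are zero (\<open>tensor_relations_if_slices_vanish\<close>),
  the cyclic identities together also imply the Jacobi identity.

  It remains to see that the cyclic identity is equivalent to the reflection condition, which is
  linear algebra over an arbitrary field. If \<open>\<beta>(x, y) = 1\<close>, the identity writes \<open>v - t v\<close> as a
  combination of \<open>x - t x\<close> and \<open>y - t y\<close>; hence \<open>1 - t\<close> has rank at most 2 and kills the radical, and
  a choice of \<open>x\<close> and \<open>y\<close> adapted to the kernel of \<open>1 - t\<close> gives the codimensions
  (\<open>reflection_condition_if_cyclic_identity\<close>). Conversely, condition (c) says that the radical is
  fixed by \<open>t\<close> and has codimension 2, so the cyclic sum is an alternating trilinear map on a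
  two-dimensional quotient and vanishes (\<open>cyclic_identity_if_Rad_plus_plane\<close>).
\<close>

section \<open>Codimension\<close>

lemma two_minus_enat: "(2 :: enat) - 1 = 1" "(2 :: enat) - 2 = 0"
  by (simp_all add: one_enat_def zero_enat_def numeral_eq_enat del: enat_numeral)

text \<open>
  Decompose each \<open>b \<in> B'\<close> as an element \<open>p b\<close> of \<open>span B\<close> plus an element of \<open>U\<close>. The linear
  extension of \<open>p\<close> changes a vector of \<open>span B'\<close> only by an element of \<open>U\<close>, and \<open>span B'\<close> meets
  \<open>U\<close> only in \<open>0\<close>, so this extension is injective and the exchange lemma in \<open>span B\<close> bounds \<open>card B'\<close>.
  The argument avoids a basis of \<open>U\<close>, which may be infinite.
\<close>

lemma (in vector_space) card_complement_le:
  assumes "independent B'" "complementary scale U (span B') W"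
    and "finite B" "complementary scale U (span B) W"
  shows "card B' \<le> card B"
proof -
  interpret vector_space_pair scale scale ..
  have "\<exists>q. q \<in> span B \<and> b - q \<in> U" if "b \<in> B'" for b
  proof -
    have "0 \<in> U"
      using assms(2) by (auto simp: complementary_def subspace_0)
    then have "b \<in> W"
      using assms(2) that unfolding complementary_def by (force intro: span_base)
    then obtain u q where "u \<in> U" "q \<in> span B" "b = u + q"
      using assms(4) unfolding complementary_def by blast
    then show ?thesis by (intro exI[of _ q]) simp
  qed
  then obtain p where p: "p b \<in> span B" "b - p b \<in> U" if "b \<in> B'" for b
    by metis
  obtain f where f: "Vector_Spaces.linear scale scale f" "\<And>b. b \<in> B' \<Longrightarrow> f b = p b"
    using linear_independent_extend[OF assms(1), of p] by blast
  interpret f: Vector_Spaces.linear scale scale f by (fact f(1))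
  have U: "subspace U"
    using assms(2) by (simp add: complementary_def)
  have "v - f v \<in> U" if "v \<in> span B'" for v
    using that
  proof (induction rule: span_induct_alt)
    case base
    show ?case using U by (simp add: subspace_0)
  next
    case (step c b v)
    have eq: "scale c b + v - f (scale c b + v) = scale c (b - f b) + (v - f v)"
      by (simp add: f.add f.scale algebra_simps)
    then show ?case
      unfolding eq using U step p f(2) by (intro subspace_add subspace_scale) auto
  qed
  then have "v = 0" if "v \<in> span B'" "f v = 0" for v
    using that assms(2) unfolding complementary_def by fastforce
  then have inj: "inj_on f (span B')"
    using f.inj_on_iff_eq_0[of "span B'"] by blast
  then have "independent (f ` B')"
    using assms(1) f.independent_injective_image by blast
  moreover have "f ` B' \<subseteq> span B"
    using f(2) p(1) by auto
  ultimately have "card (f ` B') \<le> card B"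
    using independent_span_bound[OF assms(3)] by blast
  moreover have "inj_on f B'"
    using inj inj_on_subset span_superset by blast
  ultimately show ?thesis by (simp add: card_image)
qed

text \<open>
  Any one complement determines the codimension, since two bases of complements have the same
  cardinality.
\<close>

lemma (in vector_space) codim_eq_card:
  assumes "finite B" "independent B" "complementary scale U (span B) W"
  shows "codim scale U W = enat (card B)"
proof -
  define basis where "basis = (\<lambda>B. finite B \<and> independent B \<and> complementary scale U (span B) W)"
  have "basis B" using assms by (simp add: basis_def)
  then have "basis (SOME B. basis B)" by (rule someI)
  with \<open>basis B\<close> have "card (SOME B. basis B) = card B"
    by (meson basis_def card_complement_le antisym)
  with \<open>basis B\<close> show ?thesis
    by (auto simp: codim_def Let_def basis_def)
qed

lemma (in vector_space) codim_eq_enatE: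
  assumes "codim scale U W = enat n"
  obtains B where "finite B" "independent B" "complementary scale U (span B) W" "card B = n"
proof -
  define basis where "basis = (\<lambda>B. finite B \<and> independent B \<and> complementary scale U (span B) W)"
  have *: "(if \<exists>B. basis B then enat (card (SOME B. basis B)) else \<infinity>) = enat n"
    using assms unfolding codim_def Let_def basis_def .
  then have "\<exists>B. basis B"
    by (metis enat.distinct(1))
  moreover from this * have "card (SOME B. basis B) = n"
    by simp
  ultimately show ?thesis
    using that someI_ex[of basis] unfolding basis_def by blast
qed

lemma (in vector_space) complementary_spanI:
  assumes "subspace U" "U \<subseteq> W" "subspace W" "B \<subseteq> W"
    and "\<And>v. v \<in> U \<Longrightarrow> v \<in> span B \<Longrightarrow> v = 0"
    and "\<And>v. v \<in> W \<Longrightarrow> \<exists>q \<in> span B. v - q \<in> U"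
  shows "complementary scale U (span B) W"
proof -
  have 1: "U \<inter> span B = {0}"
    using assms(1,5) by (auto simp: subspace_0 span_0)
  have "span B \<subseteq> W"
    using assms(3,4) by (rule span_minimal[rotated])
  then have 2: "{u + u' | u u'. u \<in> U \<and> u' \<in> span B} \<subseteq> W"
    using assms(2,3) by (auto intro!: subspace_add)
  have 3: "W \<subseteq> {u + u' | u u'. u \<in> U \<and> u' \<in> span B}"
  proof
    fix v assume "v \<in> W"
    then obtain q where "q \<in> span B" "v - q \<in> U" using assms(6) by blast
    then show "v \<in> {u + u' | u u'. u \<in> U \<and> u' \<in> span B}"
      by (intro CollectI exI[of _ "v - q"] exI[of _ q]) simp
  qed
  from 1 2 3 show ?thesis
    using assms(1) by (auto simp: complementary_def)
qed


section \<open>The cyclic identity for an alternating form and an endomorphism\<close>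

text \<open>
  In the application \<open>\<beta>\<close> is the coefficient of a grouplike element in the parameter map and \<open>t\<close> is
  the action of that element.
\<close>

locale twisted_alternating_form = vector_space scale
  for scale :: "'k::field \<Rightarrow> 'v::ab_group_add \<Rightarrow> 'v" (infixr "*s" 75) +
  fixes \<beta> :: "'v \<Rightarrow> 'v \<Rightarrow> 'k" and t :: "'v \<Rightarrow> 'v"
  assumes form_add: "\<beta> (u + v) w = \<beta> u w + \<beta> v w"
    and form_scale: "\<beta> (c *s v) w = c * \<beta> v w"
    and form_skew: "\<beta> w v = - \<beta> v w"
    and form_alternating: "\<beta> v v = 0"
    and twist_add: "t (v + w) = t v + t w"
    and twist_scale: "t (c *s v) = c *s t v"
begin

text \<open>
  The two sides are kept apart, as they are the coefficients of the two sides of the Jacobi identity.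
\<close>

definition cyclic_identity :: bool where
  "cyclic_identity \<longleftrightarrow> (\<forall>v1 v2 v3.
     \<beta> v2 v3 *s v1 + \<beta> v3 v1 *s v2 + \<beta> v1 v2 *s v3
     = \<beta> v1 v2 *s t v3 + \<beta> v2 v3 *s t v1 + \<beta> v3 v1 *s t v2)"

definition defect :: "'v \<Rightarrow> 'v" where
  "defect v = v - t v"

lemma form_add_right: "\<beta> u (v + w) = \<beta> u v + \<beta> u w"
  by (metis form_add form_skew minus_add_distrib)

lemma form_scale_right: "\<beta> u (c *s v) = c * \<beta> u v"
  by (metis form_scale form_skew mult_minus_right)

lemma form_minus: "\<beta> (u - v) w = \<beta> u w - \<beta> v w"
  using form_add[of "u - v" v w] by simp

lemma form_0: "\<beta> 0 w = 0" "\<beta> w 0 = 0"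
  using form_scale[of 0 0 w] form_scale_right[of w 0 0] by simp_all

lemma form_minus_right: "\<beta> w (u - v) = \<beta> w u - \<beta> w v"
  using form_add_right[of w "u - v" v] by simp

lemma defect_add: "defect (v + w) = defect v + defect w"
  and defect_scale: "defect (c *s v) = c *s defect v"
  by (simp_all add: defect_def twist_add twist_scale algebra_simps)

lemma defect_minus: "defect (v - w) = defect v - defect w"
  using defect_add[of "v - w" w] by simp

lemma Fix_iff_defect: "v \<in> Fix t \<longleftrightarrow> defect v = 0"
  by (auto simp: Fix_def defect_def)

lemma cyclic_identity_iff_defect:
  "cyclic_identity \<longleftrightarrow> (\<forall>v1 v2 v3.
     \<beta> v2 v3 *s defect v1 + \<beta> v3 v1 *s defect v2 + \<beta> v1 v2 *s defect v3 = 0)"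
proof -
  have "\<beta> v2 v3 *s defect v1 + \<beta> v3 v1 *s defect v2 + \<beta> v1 v2 *s defect v3
    = (\<beta> v2 v3 *s v1 + \<beta> v3 v1 *s v2 + \<beta> v1 v2 *s v3)
      - (\<beta> v1 v2 *s t v3 + \<beta> v2 v3 *s t v1 + \<beta> v3 v1 *s t v2)" for v1 v2 v3
    by (simp add: defect_def scale_right_diff_distrib algebra_simps)
  then show ?thesis by (simp add: cyclic_identity_def)
qed

lemma subspace_Fix: "subspace (Fix t)"
  by (rule subspaceI)
    (use twist_scale[of 0 0] in \<open>auto simp: Fix_def twist_add twist_scale\<close>)

lemma subspace_Rad: "subspace (Rad \<beta>)"
  by (rule subspaceI) (auto simp: Rad_def form_add form_scale form_0)

text \<open>
  Suppose \<open>\<beta>\<close> is nonzero and \<open>t\<close> is not the identity. If \<open>\<beta> p q = 1\<close>, the cyclic identity at \<open>p\<close>,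
  \<open>q\<close>, \<open>v\<close> expresses \<open>defect v\<close> as \<open>\<beta> v q\<close> times \<open>defect p\<close> plus \<open>\<beta> p v\<close> times \<open>defect q\<close>. Hence the
  radical is fixed, and the defect has rank at most 2. The rank is decided by whether some fixed
  vector lies outside the radical. If none does, \<open>Fix t = Rad \<beta>\<close>, and any hyperbolic pair spans a
  complement of it. If \<open>p\<close> is such a vector, choose \<open>q\<close> with \<open>\<beta> p q = 1\<close>; the defect is then
  \<open>\<beta> p\<close> times the single vector \<open>defect q\<close>, and the cyclic identity makes \<open>\<beta>\<close> the wedge of the two
  linear forms \<open>\<lambda>v. \<beta> v q\<close> and \<open>\<beta> p\<close>. So \<open>q\<close> spans a complement of \<open>Fix t\<close>, and \<open>p\<close> spans a
  complement of \<open>Rad \<beta>\<close> in \<open>Fix t\<close>.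
\<close>

lemma reflection_condition_if_cyclic_identity:
  assumes "cyclic_identity"
  shows "reflection_condition scale t \<beta>"
proof (cases "(\<forall>v w. \<beta> v w = 0) \<or> (\<forall>v. t v = v)")
  case True
  then show ?thesis unfolding reflection_condition_def by blast
next
  case False
  then obtain x0 y z where "\<beta> x0 y \<noteq> 0" and z: "t z \<noteq> z" by blast
  define x where "x = inverse (\<beta> x0 y) *s x0"
  have xy: "\<beta> x y = 1"
    using \<open>\<beta> x0 y \<noteq> 0\<close> by (simp add: x_def form_scale)
  have cyc: "\<beta> v w *s defect u + \<beta> w u *s defect v + \<beta> u v *s defect w = 0" for u v w
    using assms by (simp add: cyclic_identity_iff_defect)
  have defect_eq: "defect v = \<beta> v q *s defect p + \<beta> p v *s defect q" if "\<beta> p q = 1" for p q v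
  proof -
    have "defect v + (\<beta> q v *s defect p + \<beta> v p *s defect q) = 0"
      using cyc[of p q v] that by (simp add: algebra_simps)
    moreover have "\<beta> q v = - \<beta> v q" "\<beta> v p = - \<beta> p v" by (rule form_skew)+
    ultimately show ?thesis by (simp add: algebra_simps)
  qed
  have Rad_Fix: "Rad \<beta> \<subseteq> Fix t"
  proof
    fix v assume "v \<in> Rad \<beta>"
    then have "\<beta> v y = 0" "\<beta> x v = 0"
      using form_skew[of x v] by (simp_all add: Rad_def)
    then show "v \<in> Fix t"
      using defect_eq[OF xy, of v] by (simp add: Fix_iff_defect)
  qed
  show ?thesis
  proof (cases "Fix t \<subseteq> Rad \<beta>")
    case True
    then have eq: "Fix t = Rad \<beta>" using Rad_Fix by blast
    have yx: "\<beta> y x = -1" using form_skew[of y x] xy by simp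
    have "x \<noteq> y" using xy form_alternating[of y] by auto
    have coeffs: "a = 0 \<and> b = 0" if "a *s x + b *s y \<in> Rad \<beta>" for a b
    proof -
      have "\<beta> (a *s x + b *s y) y = 0" "\<beta> (a *s x + b *s y) x = 0"
        using that by (auto simp: Rad_def)
      then show ?thesis
        by (simp add: form_add form_scale form_alternating xy yx)
    qed
    have ind: "independent {x, y}"
    proof -
      have "x \<noteq> k *s y" for k
        using xy form_alternating[of y] by (auto simp: form_scale)
      moreover have "y \<noteq> 0" using xy form_0 by auto
      ultimately show ?thesis
        using \<open>x \<noteq> y\<close> by (auto simp: independent_insert span_singleton)
    qed
    have span: "span {x, y} = {a *s x + b *s y | a b. True}"
      by (force simp: span_insert span_singleton diff_eq_eq add.commute)
    have "complementary scale (Fix t) (span {x, y}) UNIV"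
    proof (rule complementary_spanI)
      fix v assume "v \<in> Fix t" "v \<in> span {x, y}"
      then show "v = 0" using coeffs eq by (fastforce simp: span)
    next
      fix v
      have "v - (\<beta> v y *s x + \<beta> x v *s y) \<in> Fix t"
        using defect_eq[OF xy, of v] by (simp add: Fix_iff_defect defect_minus defect_add defect_scale)
      then show "\<exists>q\<in>span {x, y}. v - q \<in> Fix t" by (auto simp: span)
    qed (simp_all add: subspace_Fix)
    then have "codim scale (Fix t) UNIV = enat (card {x, y})"
      by (intro codim_eq_card ind) simp_all
    then have 1: "codim scale (Fix t) UNIV = 2"
      using \<open>x \<noteq> y\<close> by (simp add: numeral_eq_enat)
    have "complementary scale (Rad \<beta>) (span {}) (Fix t)"
      using eq subspace_Rad by (intro complementary_spanI) (auto simp: subspace_Fix)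
    then have "codim scale (Rad \<beta>) (Fix t) = enat (card ({} :: 'v set))"
      by (intro codim_eq_card) (simp_all add: independent_empty)
    then have "codim scale (Rad \<beta>) (Fix t) = 2 - codim scale (Fix t) UNIV"
      using two_minus_enat(2) by (simp add: 1 zero_enat_def)
    with 1 Rad_Fix show ?thesis unfolding reflection_condition_def by simp
  next
    case False
    then obtain p q0 where p: "p \<in> Fix t" "\<beta> p q0 \<noteq> 0"
      by (auto simp: Rad_def)
    define q where "q = inverse (\<beta> p q0) *s q0"
    have pq: "\<beta> p q = 1"
      using p(2) by (simp add: q_def form_scale_right)
    have qp: "\<beta> q p = -1" using form_skew[of q p] pq by simp
    have defect: "defect v = \<beta> p v *s defect q" for v
      using defect_eq[OF pq, of v] p(1) by (simp add: Fix_iff_defect)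
    have "defect q \<noteq> 0" using z defect[of z] by (auto simp: defect_def)
    then have Fix_iff: "v \<in> Fix t \<longleftrightarrow> \<beta> p v = 0" for v
      by (subst Fix_iff_defect, subst defect) simp
    have form_eq: "\<beta> v w = \<beta> v q * \<beta> p w - \<beta> w q * \<beta> p v" for v w
    proof -
      have "(\<beta> v w + \<beta> w q * \<beta> p v + \<beta> q v * \<beta> p w) *s defect q = 0"
        using cyc[of v w q] defect[of v] defect[of w] by (simp add: algebra_simps)
      then have "\<beta> v w + \<beta> w q * \<beta> p v + \<beta> q v * \<beta> p w = 0"
        using \<open>defect q \<noteq> 0\<close> by simp
      then show ?thesis using form_skew[of q v] by (simp add: algebra_simps)
    qed
    have Rad_iff: "v \<in> Rad \<beta> \<longleftrightarrow> \<beta> p v = 0 \<and> \<beta> v q = 0" for v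
    proof
      assume "v \<in> Rad \<beta>"
      then show "\<beta> p v = 0 \<and> \<beta> v q = 0"
        using form_skew[of p v] by (simp add: Rad_def)
    next
      assume "\<beta> p v = 0 \<and> \<beta> v q = 0"
      then have "\<beta> v w = 0" for w by (subst form_eq) simp
      then show "v \<in> Rad \<beta>" by (simp add: Rad_def)
    qed
    have "complementary scale (Fix t) (span {q}) UNIV"
    proof (rule complementary_spanI)
      fix v assume "v \<in> Fix t" "v \<in> span {q}"
      then show "v = 0" by (auto simp: span_singleton Fix_iff form_scale_right pq)
    next
      fix v
      have "v - \<beta> p v *s q \<in> Fix t"
        by (simp add: Fix_iff form_minus_right form_scale_right pq)
      then show "\<exists>q'\<in>span {q}. v - q' \<in> Fix t" by (auto simp: span_singleton)
    qed (simp_all add: subspace_Fix)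
    moreover have "q \<noteq> 0" using pq form_0 by auto
    ultimately have "codim scale (Fix t) UNIV = enat (card {q})"
      by (intro codim_eq_card) simp_all
    then have 1: "codim scale (Fix t) UNIV = 1"
      by (simp add: one_enat_def)
    have "complementary scale (Rad \<beta>) (span {p}) (Fix t)"
    proof (rule complementary_spanI)
      fix v assume "v \<in> Rad \<beta>" "v \<in> span {p}"
      then show "v = 0" by (auto simp: span_singleton Rad_iff form_scale pq)
    next
      fix v assume "v \<in> Fix t"
      then have "v - \<beta> v q *s p \<in> Rad \<beta>"
        by (simp add: Fix_iff Rad_iff form_minus form_minus_right form_scale form_scale_right pq
            form_alternating)
      then show "\<exists>q'\<in>span {p}. v - q' \<in> Rad \<beta>" by (auto simp: span_singleton)
    qed (use p(1) Rad_Fix in \<open>simp_all add: subspace_Fix subspace_Rad\<close>)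
    moreover have "p \<noteq> 0" using pq form_0 by auto
    ultimately have "codim scale (Rad \<beta>) (Fix t) = enat (card {p})"
      by (intro codim_eq_card) simp_all
    then have "codim scale (Rad \<beta>) (Fix t) = 2 - codim scale (Fix t) UNIV"
      using two_minus_enat(1) by (simp add: 1 one_enat_def)
    with 1 Rad_Fix show ?thesis unfolding reflection_condition_def by simp
  qed
qed

text \<open>
  Since \<open>\<beta>\<close> and the defect vanish on the radical, the cyclic sum depends on its arguments only modulo
  the radical, and there they lie in the plane spanned by \<open>x\<close> and \<open>y\<close>. An alternating trilinear map on
  a plane is zero; explicitly, the coefficients of \<open>defect x\<close> and \<open>defect y\<close> are \<open>\<beta> x y\<close> times
  3-by-3 determinants with two equal rows.
\<close>

lemma cyclic_identity_if_Rad_plus_plane: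
  assumes Rad_Fix: "Rad \<beta> \<subseteq> Fix t"
    and decomp: "\<And>v. \<exists>a b. v - (a *s x + b *s y) \<in> Rad \<beta>"
  shows "cyclic_identity"
  unfolding cyclic_identity_iff_defect
proof (intro allI)
  have yx: "\<beta> y x = - \<beta> x y" by (rule form_skew)
  have cong: "\<beta> v w = \<beta> v' w'" "defect v = defect v'"
    if "v - v' \<in> Rad \<beta>" "w - w' \<in> Rad \<beta>" for v v' w w'
  proof -
    have "\<beta> v w = \<beta> v' w"
      using that(1) form_minus[of v v' w] by (simp add: Rad_def)
    also have "\<dots> = \<beta> v' w'"
      using that(2) form_minus_right[of v' w w'] form_skew[of v' "w - w'"] by (simp add: Rad_def)
    finally show "\<beta> v w = \<beta> v' w'" .
    show "defect v = defect v'"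
      using that(1) Rad_Fix defect_minus[of v v'] by (auto simp: Fix_iff_defect)
  qed
  fix v1 v2 v3
  obtain a1 b1 where 1: "v1 - (a1 *s x + b1 *s y) \<in> Rad \<beta>" using decomp by blast
  obtain a2 b2 where 2: "v2 - (a2 *s x + b2 *s y) \<in> Rad \<beta>" using decomp by blast
  obtain a3 b3 where 3: "v3 - (a3 *s x + b3 *s y) \<in> Rad \<beta>" using decomp by blast
  have d: "defect v1 = a1 *s defect x + b1 *s defect y"
    "defect v2 = a2 *s defect x + b2 *s defect y"
    "defect v3 = a3 *s defect x + b3 *s defect y"
    using cong(2)[OF 1 1] cong(2)[OF 2 2] cong(2)[OF 3 3] by (simp_all add: defect_add defect_scale)
  have f: "\<beta> v2 v3 = (a2 * b3 - a3 * b2) * \<beta> x y"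
    "\<beta> v3 v1 = (a3 * b1 - a1 * b3) * \<beta> x y"
    "\<beta> v1 v2 = (a1 * b2 - a2 * b1) * \<beta> x y"
    using cong(1)[OF 2 3] cong(1)[OF 3 1] cong(1)[OF 1 2]
    by (simp_all add: form_add form_scale form_add_right form_scale_right form_alternating yx
        algebra_simps)
  have "\<beta> v2 v3 *s defect v1 + \<beta> v3 v1 *s defect v2 + \<beta> v1 v2 *s defect v3
    = ((a2 * b3 - a3 * b2) * a1 + (a3 * b1 - a1 * b3) * a2 + (a1 * b2 - a2 * b1) * a3) *s \<beta> x y *s defect x
    + ((a2 * b3 - a3 * b2) * b1 + (a3 * b1 - a1 * b3) * b2 + (a1 * b2 - a2 * b1) * b3) *s \<beta> x y *s defect y"
    unfolding d f by (simp add: algebra_simps)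
  also have "\<dots> = 0"
    by (simp add: algebra_simps)
  finally show "\<beta> v2 v3 *s defect v1 + \<beta> v3 v1 *s defect v2 + \<beta> v1 v2 *s defect v3 = 0" .
qed

text \<open>
  In condition (c) the codimensions of \<open>Fix t\<close> in the whole space and of \<open>Rad \<beta>\<close> in \<open>Fix t\<close> add up
  to 2, so the radical has a complement spanned by two vectors.
\<close>

lemma cyclic_identity_if_reflection_condition:
  assumes "reflection_condition scale t \<beta>"
  shows "cyclic_identity"
proof -
  have decomp: "\<exists>q\<in>span B. v - q \<in> U" if "complementary scale U (span B) W" "v \<in> W" for U B W v
  proof -
    have "v \<in> {u + q | u q. u \<in> U \<and> q \<in> span B}"
      using that by (simp add: complementary_def)
    then obtain u q where "u \<in> U" "q \<in> span B" "v = u + q" by blast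
    then show ?thesis by (intro bexI[of _ q]) simp_all
  qed
  consider "\<forall>v w. \<beta> v w = 0" | "\<forall>v. t v = v"
    | "Rad \<beta> \<subseteq> Fix t" "codim scale (Fix t) UNIV = enat 1" "codim scale (Rad \<beta>) (Fix t) = enat 1"
    | "Rad \<beta> \<subseteq> Fix t" "codim scale (Fix t) UNIV = enat 2" "codim scale (Rad \<beta>) (Fix t) = enat 0"
    using assms two_minus_enat unfolding reflection_condition_def
    by (metis one_enat_def numeral_eq_enat zero_enat_def)
  then show ?thesis
  proof cases
    case 1
    then show ?thesis by (simp add: cyclic_identity_def)
  next
    case 2
    then show ?thesis by (simp add: cyclic_identity_iff_defect defect_def)
  next
    case 3
    obtain y where y: "complementary scale (Fix t) (span {y}) UNIV"
      using codim_eq_enatE[OF 3(2)] by (metis card_1_singletonE One_nat_def)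
    obtain x where x: "complementary scale (Rad \<beta>) (span {x}) (Fix t)"
      using codim_eq_enatE[OF 3(3)] by (metis card_1_singletonE One_nat_def)
    show ?thesis
    proof (rule cyclic_identity_if_Rad_plus_plane[OF 3(1)])
      fix v
      obtain b where b: "v - b *s y \<in> Fix t"
        using decomp[OF y, of v] by (auto simp: span_singleton)
      then obtain a where "v - b *s y - a *s x \<in> Rad \<beta>"
        using decomp[OF x b] by (auto simp: span_singleton)
      then show "\<exists>a b. v - (a *s x + b *s y) \<in> Rad \<beta>"
        by (intro exI[of _ a] exI[of _ b]) (simp add: algebra_simps)
    qed
  next
    case 4
    obtain B where B: "finite B" "complementary scale (Fix t) (span B) UNIV" "card B = 2"
      using codim_eq_enatE[OF 4(2)] .
    then obtain x y where "B = {x, y}" by (auto simp: card_2_iff)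
    with B have xy: "complementary scale (Fix t) (span {x, y}) UNIV" by simp
    obtain C where "finite C" "complementary scale (Rad \<beta>) (span C) (Fix t)" "card C = 0"
      using codim_eq_enatE[OF 4(3)] .
    then have "Fix t \<subseteq> Rad \<beta>" by (auto simp: complementary_def)
    show ?thesis
    proof (rule cyclic_identity_if_Rad_plus_plane[OF 4(1)])
      fix v
      obtain q where q: "q \<in> span {x, y}" "v - q \<in> Fix t"
        using decomp[OF xy, of v] by auto
      then obtain a where "q - a *s x \<in> span {y}"
        by (auto simp: span_insert)
      then obtain b where "q - a *s x = b *s y" by (auto simp: span_singleton)
      then have "q = a *s x + b *s y" by (simp add: algebra_simps)
      then show "\<exists>a b. v - (a *s x + b *s y) \<in> Rad \<beta>"
        using q(2) \<open>Fix t \<subseteq> Rad \<beta>\<close> by blast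
    qed
  qed
qed

end


section \<open>Linear maps out of tensor products\<close>

lemma lookup_free_scale: "Poly_Mapping.lookup (free_scale c x) p = c * Poly_Mapping.lookup x p"
  by (simp add: free_scale_def Poly_Mapping.map.rep_eq when_def)

interpretation free: vector_space "free_scale :: 'k::field \<Rightarrow> ('x \<Rightarrow>\<^sub>0 'k) \<Rightarrow> ('x \<Rightarrow>\<^sub>0 'k)"
  by unfold_locales
    (auto intro!: poly_mapping_eqI simp: lookup_free_scale lookup_add algebra_simps)

definition free_lift ::
  "('k::field \<Rightarrow> 'v::ab_group_add \<Rightarrow> 'v) \<Rightarrow> ('x \<Rightarrow> 'v) \<Rightarrow> ('x \<Rightarrow>\<^sub>0 'k) \<Rightarrow> 'v" where
  "free_lift s f x = (\<Sum>p\<in>Poly_Mapping.keys x. s (Poly_Mapping.lookup x p) (f p))"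

lemma keys_gen: "Poly_Mapping.keys (gen p :: 'x \<Rightarrow>\<^sub>0 'k::field) = {p}"
  by (simp add: gen_def)

lemma free_lift_gen_self: "free_lift free_scale gen x = x"
proof (rule poly_mapping_eqI)
  fix p
  have "Poly_Mapping.lookup (free_lift free_scale gen x) p
    = (\<Sum>q\<in>Poly_Mapping.keys x. if q = p then Poly_Mapping.lookup x q else 0)"
    unfolding free_lift_def lookup_sum
    by (intro sum.cong) (auto simp: lookup_free_scale gen_def lookup_single when_def)
  then show "Poly_Mapping.lookup (free_lift free_scale gen x) p = Poly_Mapping.lookup x p"
    by (simp add: in_keys_iff)
qed

context vector_space
begin

lemma free_lift_superset:
  assumes "finite S" "Poly_Mapping.keys x \<subseteq> S"
  shows "free_lift scale f x = (\<Sum>p\<in>S. scale (Poly_Mapping.lookup x p) (f p))"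
  unfolding free_lift_def using assms by (intro sum.mono_neutral_left) (auto simp: in_keys_iff)

lemma linear_free_lift: "Vector_Spaces.linear free_scale scale (free_lift scale f)"
  unfolding Vector_Spaces.linear_iff
proof (intro conjI allI)
  show "free_lift scale f (x + y) = free_lift scale f x + free_lift scale f y" for x y
  proof -
    let ?S = "Poly_Mapping.keys x \<union> Poly_Mapping.keys y"
    have "free_lift scale f (x + y)
      = (\<Sum>p\<in>?S. scale (Poly_Mapping.lookup (x + y) p) (f p))"
      using keys_add[of x y] by (intro free_lift_superset) auto
    also have "\<dots> = (\<Sum>p\<in>?S. scale (Poly_Mapping.lookup x p) (f p))
        + (\<Sum>p\<in>?S. scale (Poly_Mapping.lookup y p) (f p))"
      by (simp add: lookup_add scale_left_distrib sum.distrib)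
    also have "\<dots> = free_lift scale f x + free_lift scale f y"
      by (subst (1 2) free_lift_superset[of ?S]) auto
    finally show ?thesis .
  qed
  show "free_lift scale f (free_scale c x) = scale c (free_lift scale f x)" for c x
  proof -
    have "free_lift scale f (free_scale c x)
      = (\<Sum>p\<in>Poly_Mapping.keys x. scale (Poly_Mapping.lookup (free_scale c x) p) (f p))"
      by (intro free_lift_superset) (auto simp: in_keys_iff lookup_free_scale)
    then show ?thesis
      by (simp add: free_lift_def lookup_free_scale scale_sum_right)
  qed
qed unfold_locales

lemma free_lift_gen: "free_lift scale f (gen p) = f p"
  by (simp add: free_lift_def keys_gen) (simp add: gen_def)

lemma linear_free_extend:
  assumes "Vector_Spaces.linear free_scale scale L"
  shows "L (free_extend f x) = free_lift scale (\<lambda>p. L (f p)) x"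
proof -
  interpret L: Vector_Spaces.linear free_scale scale L by fact
  show ?thesis by (simp add: free_extend_def free_lift_def L.sum L.scale)
qed

end

text \<open>
  For \<open>g u = gen (u, w)\<close> or \<open>g w = gen (u, w)\<close>, which are linear only modulo the tensor relations.
\<close>

lemma (in vector_space_pair) sum_modulo_subspace:
  assumes R: "vs2.subspace R"
    and add: "\<And>u v. g (u + v) - g u - g v \<in> R"
    and scale: "\<And>c v. g (s1 c v) - s2 c (g v) \<in> R"
  shows "g (\<Sum>i\<in>I. s1 (c i) (f i)) - (\<Sum>i\<in>I. s2 (c i) (g (f i))) \<in> R"
proof (induction I rule: infinite_finite_induct)
  case (insert i I)
  let ?u = "s1 (c i) (f i)" and ?v = "\<Sum>i\<in>I. s1 (c i) (f i)"
  have "g (?u + ?v) - (s2 (c i) (g (f i)) + (\<Sum>i\<in>I. s2 (c i) (g (f i))))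
    = (g (?u + ?v) - g ?u - g ?v) + (g ?u - s2 (c i) (g (f i)))
      + (g ?v - (\<Sum>i\<in>I. s2 (c i) (g (f i))))"
    by simp
  also have "\<dots> \<in> R"
    using insert by (intro vs2.subspace_add R add scale)
  finally show ?case using insert by simp
qed (use scale[of 0 0] in simp_all)

definition bilinear_map ::
  "('k::field \<Rightarrow> 'u::ab_group_add \<Rightarrow> 'u) \<Rightarrow> ('k \<Rightarrow> 'w::ab_group_add \<Rightarrow> 'w) \<Rightarrow>
   ('k \<Rightarrow> 'x::ab_group_add \<Rightarrow> 'x) \<Rightarrow> ('u \<Rightarrow> 'w \<Rightarrow> 'x) \<Rightarrow> bool" where
  "bilinear_map sU sW sX f \<longleftrightarrow>
     (\<forall>w. Vector_Spaces.linear sU sX (\<lambda>u. f u w)) \<and> (\<forall>u. Vector_Spaces.linear sW sX (f u))"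

lemma subspace_tensor_relations: "free.subspace (tensor_relations sU sW)"
  unfolding tensor_relations_def by (rule free.subspace_span)

lemma gen_bilinear_modulo_relations:
  "gen (u + u', w) - gen (u, w) - gen (u', w) \<in> tensor_relations sU sW"
  "gen (u, w + w') - gen (u, w) - gen (u, w') \<in> tensor_relations sU sW"
  "gen (sU c u, w) - free_scale c (gen (u, w)) \<in> tensor_relations sU sW"
  "gen (u, sW c w) - free_scale c (gen (u, w)) \<in> tensor_relations sU sW"
  unfolding tensor_relations_def by (rule free.span_base; blast)+

lemma tensor_class_eq_iff:
  "tensor_class sU sW x = tensor_class sU sW y \<longleftrightarrow> x - y \<in> tensor_relations sU sW"
proof
  note R = subspace_tensor_relations[of sU sW]
  show "x - y \<in> tensor_relations sU sW" if "tensor_class sU sW x = tensor_class sU sW y"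
  proof -
    have "x \<in> tensor_class sU sW x"
      using R by (simp add: tensor_class_def free.subspace_0)
    with that show ?thesis by (simp add: tensor_class_def)
  qed
  show "tensor_class sU sW x = tensor_class sU sW y" if "x - y \<in> tensor_relations sU sW"
  proof -
    have "z - x \<in> tensor_relations sU sW \<longleftrightarrow> z - y \<in> tensor_relations sU sW" for z
      using free.subspace_add[OF R _ that, of "z - x"] free.subspace_diff[OF R _ that, of "z - y"]
      by auto
    then show ?thesis by (simp add: tensor_class_def)
  qed
qed

lemma tensor_class_rep: "tensor_class sU sW (rep (tensor_class sU sW x)) = tensor_class sU sW x"
proof -
  have "x \<in> tensor_class sU sW x"
    by (simp add: tensor_class_def free.subspace_0[OF subspace_tensor_relations])
  then have "rep (tensor_class sU sW x) \<in> tensor_class sU sW x"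
    unfolding rep_def by (rule someI)
  then show ?thesis
    unfolding tensor_class_eq_iff by (simp add: tensor_class_def)
qed

lemma tensor_add_class:
  "tensor_add sU sW (tensor_class sU sW x) (tensor_class sU sW y) = tensor_class sU sW (x + y)"
proof -
  have "rep (tensor_class sU sW x) - x + (rep (tensor_class sU sW y) - y) \<in> tensor_relations sU sW"
    using tensor_class_rep[of sU sW]
    by (intro free.subspace_add[OF subspace_tensor_relations]) (simp_all add: tensor_class_eq_iff)
  then show ?thesis
    by (simp add: tensor_add_def tensor_class_eq_iff algebra_simps)
qed

lemma tensor_scale_class:
  "tensor_scale sU sW c (tensor_class sU sW x) = tensor_class sU sW (free_scale c x)"
proof -
  have "free_scale c (rep (tensor_class sU sW x) - x) \<in> tensor_relations sU sW"
    using tensor_class_rep[of sU sW]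
    by (intro free.subspace_scale[OF subspace_tensor_relations]) (simp_all add: tensor_class_eq_iff)
  then show ?thesis
    by (simp add: tensor_scale_def tensor_class_eq_iff free.scale_right_diff_distrib)
qed

text \<open>
  The universal property: a bilinear map factors through the tensor product, so its values on formal
  sums may be computed from any representative, in particular from \<open>rep\<close>.
\<close>

context
  fixes sU :: "'k::field \<Rightarrow> 'u::ab_group_add \<Rightarrow> 'u"
    and sW :: "'k \<Rightarrow> 'w::ab_group_add \<Rightarrow> 'w"
    and sX :: "'k \<Rightarrow> 'x::ab_group_add \<Rightarrow> 'x"
    and f :: "'u \<Rightarrow> 'w \<Rightarrow> 'x"
  assumes f: "bilinear_map sU sW sX f"
begin

lemma free_lift_tensor_relations:
  assumes "x \<in> tensor_relations sU sW"
  shows "free_lift sX (\<lambda>(u, w). f u w) x = 0"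
proof -
  let ?L = "free_lift sX (\<lambda>(u, w). f u w)"
  have f1: "Vector_Spaces.linear sU sX (\<lambda>u. f u w)" and f2: "Vector_Spaces.linear sW sX (f u)" for u w
    using f by (auto simp: bilinear_map_def)
  interpret X: vector_space sX
    using f1 unfolding Vector_Spaces.linear_iff by blast
  interpret L: Vector_Spaces.linear free_scale sX ?L
    by (rule X.linear_free_lift)
  note bil = f1[unfolded Vector_Spaces.linear_iff] f2[unfolded Vector_Spaces.linear_iff]
  have "tensor_relations sU sW \<subseteq> {x. ?L x = 0}"
    unfolding tensor_relations_def
    by (intro free.span_minimal L.subspace_kernel)
      (auto simp: L.diff L.scale X.free_lift_gen bil)
  with assms show ?thesis by blast
qed

lemma free_lift_cong_class:
  assumes "tensor_class sU sW x = tensor_class sU sW y"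
  shows "free_lift sX (\<lambda>(u, w). f u w) x = free_lift sX (\<lambda>(u, w). f u w) y"
proof -
  interpret X: vector_space sX
    using f unfolding bilinear_map_def Vector_Spaces.linear_iff by blast
  interpret L: Vector_Spaces.linear free_scale sX "free_lift sX (\<lambda>(u, w). f u w)"
    by (rule X.linear_free_lift)
  show ?thesis
    using free_lift_tensor_relations assms L.diff[of x y] by (simp add: tensor_class_eq_iff)
qed

lemma free_lift_rep:
  "free_lift sX (\<lambda>(u, w). f u w) (rep (tensor_class sU sW x)) = free_lift sX (\<lambda>(u, w). f u w) x"
  by (rule free_lift_cong_class) (rule tensor_class_rep)

end

section \<open>Coordinates of a tensor with respect to a basis of the second factor\<close>

text \<open>
  The map \<open>id \<otimes> b\<^sup>*\<close> from \<open>U \<otimes> W\<close> to \<open>U\<close>, where \<open>b\<^sup>*\<close> is the coordinate form of \<open>b\<close> in the basis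
  \<open>B\<close>. It is defined on formal sums because tensors are compared through these.
\<close>

definition slice ::
  "('k::field \<Rightarrow> 'u::ab_group_add \<Rightarrow> 'u) \<Rightarrow> ('k \<Rightarrow> 'w::ab_group_add \<Rightarrow> 'w) \<Rightarrow> 'w set \<Rightarrow> 'w \<Rightarrow>
   ('u \<times> 'w \<Rightarrow>\<^sub>0 'k) \<Rightarrow> 'u" where
  "slice sU sW B b = free_lift sU (\<lambda>(u, w). sU (module.representation sW B w b) u)"

locale tensor_with_basis = U: vector_space sU + W: vector_space sW
  for sU :: "'k::field \<Rightarrow> 'u::ab_group_add \<Rightarrow> 'u"
    and sW :: "'k \<Rightarrow> 'w::ab_group_add \<Rightarrow> 'w" +
  fixes B :: "'w set"
  assumes independent_basis: "W.independent B" and span_basis: "W.span B = UNIV"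
begin

lemma representation_linear:
  "W.representation B (v + w) b = W.representation B v b + W.representation B w b"
  "W.representation B (sW c w) b = c * W.representation B w b"
  using independent_basis
  by (simp_all add: W.representation_add W.representation_scale span_basis)

lemma linear_slice: "Vector_Spaces.linear free_scale sU (slice sU sW B b)"
  unfolding slice_def by (rule U.linear_free_lift)

lemma slice_gen: "slice sU sW B b (gen (u, w)) = sU (W.representation B w b) u"
  by (simp add: slice_def U.free_lift_gen)

lemma bilinear_coefficient_scale:
  "bilinear_map sU sW sU (\<lambda>u w. sU (W.representation B w b) u)"
  unfolding bilinear_map_def Vector_Spaces.linear_iff
  by (auto simp: representation_linear U.scale_right_distrib U.scale_left_distrib mult.commute
      intro: U.vector_space_axioms W.vector_space_axioms)

lemma slice_cong_class:
  assumes "tensor_class sU sW x = tensor_class sU sW y"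
  shows "slice sU sW B b x = slice sU sW B b y"
  unfolding slice_def by (rule free_lift_cong_class[OF bilinear_coefficient_scale assms])

text \<open>
  The slices separate tensors because every tensor equals the sum of \<open>slice b x \<otimes> b\<close> over the
  finitely many \<open>b\<close> that occur in its second components.
\<close>

lemma tensor_relations_if_slices_vanish:
  assumes slices: "\<And>b. b \<in> B \<Longrightarrow> slice sU sW B b x = 0"
  shows "x \<in> tensor_relations sU sW"
proof -
  let ?R = "tensor_relations sU sW" and ?K = "Poly_Mapping.keys x"
  note R = subspace_tensor_relations[of sU sW]
  interpret UF: vector_space_pair sU "free_scale :: 'k \<Rightarrow> ('u \<times> 'w \<Rightarrow>\<^sub>0 'k) \<Rightarrow> _" ..
  interpret WF: vector_space_pair sW "free_scale :: 'k \<Rightarrow> ('u \<times> 'w \<Rightarrow>\<^sub>0 'k) \<Rightarrow> _" ..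
  define c where "c p b = W.representation B (snd p) b" for p :: "'u \<times> 'w" and b
  define l where "l = Poly_Mapping.lookup x"
  define F where "F = (\<Union>p\<in>?K. {b. c p b \<noteq> 0})"
  have "finite F"
    unfolding F_def c_def by (simp add: W.finite_representation)
  have "F \<subseteq> B"
    unfolding F_def c_def using W.representation_ne_zero by auto
  \<comment> \<open>\<open>y\<close> expands every second component in the basis; collecting its terms by \<open>b\<close> gives the slices.\<close>
  define y where "y = (\<Sum>p\<in>?K. free_scale (l p) (\<Sum>b\<in>F. free_scale (c p b) (gen (fst p, b))))"
  have "gen p - (\<Sum>b\<in>F. free_scale (c p b) (gen (fst p, b))) \<in> ?R" if "p \<in> ?K" for p
  proof -
    have "(\<Sum>b\<in>F. sW (c p b) b) = (\<Sum>b | c p b \<noteq> 0. sW (c p b) b)"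
      using that \<open>finite F\<close> by (intro sum.mono_neutral_right) (auto simp: F_def)
    also have "\<dots> = snd p"
      unfolding c_def using independent_basis
      by (intro W.sum_nonzero_representation_eq) (simp_all add: span_basis)
    finally have "(\<Sum>b\<in>F. sW (c p b) b) = snd p" .
    then show ?thesis
      using WF.sum_modulo_subspace[of ?R "\<lambda>w. gen (fst p, w)" "c p" "\<lambda>b. b" F] R
      by (simp add: gen_bilinear_modulo_relations)
  qed
  then have "(\<Sum>p\<in>?K. free_scale (l p)
      (gen p - (\<Sum>b\<in>F. free_scale (c p b) (gen (fst p, b))))) \<in> ?R"
    by (intro free.subspace_sum free.subspace_scale R)
  moreover have "(\<Sum>p\<in>?K. free_scale (l p) (gen p)) = x"
    using free_lift_gen_self[of x] by (simp add: free_lift_def l_def)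
  ultimately have xy: "x - y \<in> ?R"
    by (simp add: y_def free.scale_right_diff_distrib sum_subtractf)
  have y_eq: "y = (\<Sum>b\<in>F. \<Sum>p\<in>?K. free_scale (l p * c p b) (gen (fst p, b)))"
    unfolding y_def by (simp add: free.scale_sum_right sum.swap[of _ F])
  have zero: "gen (0, b) \<in> ?R" for b
    using gen_bilinear_modulo_relations(3)[of sU 0 0 b sW] by simp
  have "(\<Sum>p\<in>?K. free_scale (l p * c p b) (gen (fst p, b))) \<in> ?R" if "b \<in> F" for b
  proof -
    have "(\<Sum>p\<in>?K. sU (l p * c p b) (fst p)) = slice sU sW B b x"
      by (simp add: slice_def free_lift_def l_def c_def case_prod_unfold)
    also have "\<dots> = 0"
      using that \<open>F \<subseteq> B\<close> slices by blast
    finally have "gen (0, b) - (\<Sum>p\<in>?K. free_scale (l p * c p b) (gen (fst p, b))) \<in> ?R"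
      using UF.sum_modulo_subspace[of ?R "\<lambda>u. gen (u, b)" "\<lambda>p. l p * c p b" fst ?K] R
      by (simp add: gen_bilinear_modulo_relations)
    from free.subspace_diff[OF R zero[of b] this] show ?thesis by simp
  qed
  then have "y \<in> ?R"
    unfolding y_eq by (rule free.subspace_sum[OF R])
  from free.subspace_add[OF R xy this] show ?thesis by simp
qed

end

section \<open>The parameter map as an alternating bilinear map\<close>

locale wedge_map = V: vector_space sV + A: vector_space sA
  for sV :: "'k::field \<Rightarrow> 'v::ab_group_add \<Rightarrow> 'v" and sA :: "'k \<Rightarrow> 'a::ab_group_add \<Rightarrow> 'a" +
  fixes \<kappa> :: "('k, 'v, 'v) tensor \<Rightarrow> 'a"
  assumes kappa_linear: "wedge_linear sV sA \<kappa>"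
begin

lemma wedge_in_wedge_space: "wedge sV v w \<in> wedge_space sV"
  unfolding wedge_def wedge_space_def by (intro imageI free.span_base) blast

lemma kappa_tensor_add:
  "\<kappa> (tensor_add sV sV (wedge sV u v) (wedge sV u' v')) = \<kappa> (wedge sV u v) + \<kappa> (wedge sV u' v')"
  and kappa_tensor_scale:
  "\<kappa> (tensor_scale sV sV c (wedge sV u v)) = sA c (\<kappa> (wedge sV u v))"
  using kappa_linear wedge_in_wedge_space by (auto simp: wedge_linear_def)

lemma kappa_wedge_add: "\<kappa> (wedge sV (u + v) w) = \<kappa> (wedge sV u w) + \<kappa> (wedge sV v w)"
proof -
  have "(gen (u + v, w) - gen (u, w) - gen (v, w)) - (gen (w, u + v) - gen (w, u) - gen (w, v))
    \<in> tensor_relations sV sV"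
    by (intro free.subspace_diff subspace_tensor_relations gen_bilinear_modulo_relations)
  then have "wedge sV (u + v) w = tensor_add sV sV (wedge sV u w) (wedge sV v w)"
    by (simp add: wedge_def tensor_add_class tensor_class_eq_iff algebra_simps)
  then show ?thesis by (simp add: kappa_tensor_add)
qed

lemma kappa_wedge_scale: "\<kappa> (wedge sV (sV c v) w) = sA c (\<kappa> (wedge sV v w))"
proof -
  have "(gen (sV c v, w) - free_scale c (gen (v, w))) - (gen (w, sV c v) - free_scale c (gen (w, v)))
    \<in> tensor_relations sV sV"
    by (intro free.subspace_diff subspace_tensor_relations gen_bilinear_modulo_relations)
  then have "wedge sV (sV c v) w = tensor_scale sV sV c (wedge sV v w)"
    by (simp add: wedge_def tensor_scale_class tensor_class_eq_iff algebra_simps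
        free.scale_right_diff_distrib)
  then show ?thesis by (simp add: kappa_tensor_scale)
qed

lemma kappa_wedge_skew: "\<kappa> (wedge sV w v) = - \<kappa> (wedge sV v w)"
proof -
  have "wedge sV w v = tensor_scale sV sV (- 1) (wedge sV v w)"
    by (simp add: wedge_def tensor_scale_class free.scale_minus_left)
  then show ?thesis by (simp add: kappa_tensor_scale A.scale_minus_left)
qed

lemma kappa_wedge_self: "\<kappa> (wedge sV v v) = 0"
proof -
  have "wedge sV v v = tensor_scale sV sV 0 (wedge sV v v)"
    by (simp add: wedge_def tensor_scale_class)
  then have "\<kappa> (wedge sV v v) = sA 0 (\<kappa> (wedge sV v v))"
    by (metis kappa_tensor_scale)
  then show ?thesis by simp
qed

end

section \<open>Separating the Jacobi identity into its coefficients\<close>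

context algebra_module
begin

lemma act_scale_right: "act a (sV c v) = sV c (act a v)"
proof -
  have "act a (sV c v) = act (a * sA c 1) v"
    by (simp add: act_mult act_scale act_one)
  then show ?thesis by (simp add: A.scale_mult_right act_scale)
qed

text \<open>
  Both sides are linear in \<open>a\<close>, so they may be compared on the basis. At \<open>T\<close> they agree because \<open>T\<close>
  is grouplike. At any other basis vector the second tensor factors of the coproduct lie in the span
  of the basis without \<open>T\<close>, where the \<open>T\<close>-coordinate is zero.
\<close>

lemma slice_coproduct_act:
  assumes \<Delta>: "algebra_coproduct sA \<Delta>"
    and B: "A.independent B" "A.span B = UNIV" and T: "T \<in> B" "\<Delta> T = pure_tensor sA sA T T"
    and other: "\<And>b. b \<in> B - {T} \<Longrightarrow>
      \<exists>x. \<Delta> b = tensor_class sA sA x \<and> Poly_Mapping.keys x \<subseteq> UNIV \<times> A.span (B - {T})"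
  shows "slice sV sA B T (coproduct_act act \<Delta> a v) = sV (A.representation B a T) (act T v)"
proof -
  interpret \<Delta>: algebra_coproduct sA \<Delta> by fact
  interpret VA: tensor_with_basis sV sA B
    using B by unfold_locales
  interpret AV: vector_space_pair sA sV ..
  define f where "f p q = sV (A.representation B q T) (act p v)" for p q
  have f: "bilinear_map sA sA sV f"
    unfolding bilinear_map_def Vector_Spaces.linear_iff f_def
    by (auto simp: VA.representation_linear act_add_left act_scale V.scale_right_distrib
        V.scale_left_distrib mult.commute intro: V.vector_space_axioms A.vector_space_axioms)
  let ?L = "free_lift sV (\<lambda>(p, q). f p q)"
  interpret L: Vector_Spaces.linear free_scale sV ?L
    by (rule V.linear_free_lift)
  define h where "h a = ?L (rep (\<Delta> a))" for a
  have slice_eq: "slice sV sA B T (coproduct_act act \<Delta> a v) = h a" for a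
    unfolding coproduct_act_def V.linear_free_extend[OF VA.linear_slice] h_def
    by (simp add: VA.slice_gen f_def case_prod_unfold)
  have "Vector_Spaces.linear sA sV h"
    unfolding Vector_Spaces.linear_iff h_def \<Delta>.coproduct_add \<Delta>.coproduct_scale
      tensor_add_def tensor_scale_def free_lift_rep[OF f]
    by (simp add: L.add L.scale V.vector_space_axioms A.vector_space_axioms)
  moreover have "Vector_Spaces.linear sA sV (\<lambda>a. sV (A.representation B a T) (act T v))"
    unfolding Vector_Spaces.linear_iff
    by (simp add: VA.representation_linear V.scale_left_distrib V.vector_space_axioms
        A.vector_space_axioms)
  moreover have "a \<in> A.span B" using B(2) by simp
  moreover have "h b = sV (A.representation B b T) (act T v)" if "b \<in> B" for b
  proof (cases "b = T")
    case True
    then have "h b = ?L (gen (T, T))"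
      using T(2) free_lift_rep[OF f] by (simp add: h_def pure_tensor_def)
    then show ?thesis
      using True by (simp add: V.free_lift_gen f_def)
  next
    case False
    then obtain x where x: "\<Delta> b = tensor_class sA sA x"
      "Poly_Mapping.keys x \<subseteq> UNIV \<times> A.span (B - {T})"
      using other \<open>b \<in> B\<close> by blast
    have "A.representation B q T = 0" if "q \<in> A.span (B - {T})" for q
    proof -
      have "A.representation B q = A.representation (B - {T}) q"
        using that B(1) by (intro A.representation_extend) auto
      then show ?thesis using A.representation_ne_zero[of "B - {T}" q T] by auto
    qed
    then have "?L x = 0"
      unfolding free_lift_def using x(2) by (intro sum.neutral) (auto simp: f_def)
    moreover have "A.representation B b T = 0"
      using False B(1) \<open>b \<in> B\<close> by (simp add: A.representation_basis)
    ultimately show ?thesis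
      by (simp add: h_def x(1) free_lift_rep[OF f])
  qed
  ultimately have "h a = sV (A.representation B a T) (act T v)"
    by (rule AV.linear_eq_on)
  then show ?thesis by (simp add: slice_eq)
qed

end

locale jacobi_data = algebra_module sA sV act + wedge_map sV sA \<kappa> +
  algebra_coproduct sA \<Delta> + tensor_with_basis sV sA B
  for sA :: "'k::field \<Rightarrow> 'a::ring_1 \<Rightarrow> 'a" and sV :: "'k \<Rightarrow> 'v::ab_group_add \<Rightarrow> 'v"
    and act :: "'a \<Rightarrow> 'v \<Rightarrow> 'v" and \<Delta> :: "'a \<Rightarrow> ('k, 'a, 'a) tensor"
    and \<kappa> :: "('k, 'v, 'v) tensor \<Rightarrow> 'a" and B :: "'a set"
begin

text \<open>
  This covers both directions of the theorem: a complement \<open>V\<^sub>0\<close> of \<open>T\<close> with \<open>\<Delta>(V\<^sub>0) \<subseteq> V\<^sub>0 \<otimes> V\<^sub>0\<close>, and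
  a basis that consists of grouplike elements.
\<close>

definition splits_off :: "'a \<Rightarrow> bool" where
  "splits_off T \<longleftrightarrow> T \<in> B \<and> \<Delta> T = pure_tensor sA sA T T \<and>
     (\<forall>b\<in>B - {T}. \<exists>x. \<Delta> b = tensor_class sA sA x \<and> Poly_Mapping.keys x \<subseteq> UNIV \<times> A.span (B - {T}))"

lemma twisted_alternating_form:
  "twisted_alternating_form sV (kappa_coeff sA sV \<kappa> B T) (act T)"
proof -
  have neg: "A.representation B (- a) T = - A.representation B a T" for a
    using independent_basis by (simp add: A.representation_neg span_basis)
  show ?thesis
    by unfold_locales
      (simp_all add: kappa_coeff_def kappa_wedge_add kappa_wedge_scale kappa_wedge_self
        representation_linear A.representation_zero act_add_right act_scale_right
        flip: neg kappa_wedge_skew)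
qed

definition jacobi_left :: "'v \<Rightarrow> 'v \<Rightarrow> 'v \<Rightarrow> ('v \<times> 'a \<Rightarrow>\<^sub>0 'k)" where
  "jacobi_left v1 v2 v3 =
     gen (v1, \<kappa> (wedge sV v2 v3)) + gen (v2, \<kappa> (wedge sV v3 v1)) + gen (v3, \<kappa> (wedge sV v1 v2))"

definition jacobi_right :: "'v \<Rightarrow> 'v \<Rightarrow> 'v \<Rightarrow> ('v \<times> 'a \<Rightarrow>\<^sub>0 'k)" where
  "jacobi_right v1 v2 v3 =
     coproduct_act act \<Delta> (\<kappa> (wedge sV v1 v2)) v3
     + coproduct_act act \<Delta> (\<kappa> (wedge sV v2 v3)) v1
     + coproduct_act act \<Delta> (\<kappa> (wedge sV v3 v1)) v2"

lemma jacobi_iff_classes_eq: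
  "jacobi sA sV act \<Delta> \<kappa> \<longleftrightarrow>
     (\<forall>v1 v2 v3. tensor_class sV sA (jacobi_left v1 v2 v3) = tensor_class sV sA (jacobi_right v1 v2 v3))"
  by (simp add: jacobi_def jacobi_left_def jacobi_right_def)

lemma cyclic_identity_iff_slices_eq:
  assumes "splits_off T"
  shows "twisted_alternating_form.cyclic_identity sV (kappa_coeff sA sV \<kappa> B T) (act T) \<longleftrightarrow>
    (\<forall>v1 v2 v3. slice sV sA B T (jacobi_left v1 v2 v3) = slice sV sA B T (jacobi_right v1 v2 v3))"
proof -
  interpret S: Vector_Spaces.linear free_scale sV "slice sV sA B T"
    by (rule linear_slice)
  have act: "slice sV sA B T (coproduct_act act \<Delta> a v) = sV (A.representation B a T) (act T v)" for a v
    using assms independent_basis span_basis unfolding splits_off_def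
    by (intro slice_coproduct_act algebra_coproduct_axioms) auto
  show ?thesis
    unfolding twisted_alternating_form.cyclic_identity_def[OF twisted_alternating_form]
    by (simp add: jacobi_left_def jacobi_right_def S.add slice_gen act kappa_coeff_def)
qed

lemma reflection_condition_if_jacobi:
  assumes "splits_off T" "jacobi sA sV act \<Delta> \<kappa>"
  shows "reflection_condition sV (act T) (kappa_coeff sA sV \<kappa> B T)"
proof (rule twisted_alternating_form.reflection_condition_if_cyclic_identity
    [OF twisted_alternating_form])
  show "twisted_alternating_form.cyclic_identity sV (kappa_coeff sA sV \<kappa> B T) (act T)"
    unfolding cyclic_identity_iff_slices_eq[OF assms(1)]
    using assms(2) slice_cong_class unfolding jacobi_iff_classes_eq by blast
qed

lemma jacobi_if_reflection_conditions:
  assumes "\<And>T. T \<in> B \<Longrightarrow> splits_off T"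
    and "\<And>T. T \<in> B \<Longrightarrow> reflection_condition sV (act T) (kappa_coeff sA sV \<kappa> B T)"
  shows "jacobi sA sV act \<Delta> \<kappa>"
  unfolding jacobi_iff_classes_eq tensor_class_eq_iff
proof (intro allI tensor_relations_if_slices_vanish)
  fix v1 v2 v3 T assume T: "T \<in> B"
  interpret S: Vector_Spaces.linear free_scale sV "slice sV sA B T"
    by (rule linear_slice)
  have "twisted_alternating_form.cyclic_identity sV (kappa_coeff sA sV \<kappa> B T) (act T)"
    by (rule twisted_alternating_form.cyclic_identity_if_reflection_condition
        [OF twisted_alternating_form assms(2)[OF T]])
  then show "slice sV sA B T (jacobi_left v1 v2 v3 - jacobi_right v1 v2 v3) = 0"
    unfolding cyclic_identity_iff_slices_eq[OF assms(1)[OF T]] S.diff by simp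
qed

end

section \<open>The Jacobi identity and the reflection conditions\<close>

theorem theorem5p10:
  fixes sA :: "'k::field \<Rightarrow> 'a::ring_1 \<Rightarrow> 'a"
    and sV :: "'k \<Rightarrow> 'v::ab_group_add \<Rightarrow> 'v"
    and act :: "'a \<Rightarrow> 'v \<Rightarrow> 'v"
    and \<Delta> :: "'a \<Rightarrow> ('k, 'a, 'a) tensor"
    and \<kappa> :: "('k, 'v, 'v) tensor \<Rightarrow> 'a"
  assumes V_module: "algebra_module sA sV act"
    and kappa_linear: "wedge_linear sV sA \<kappa>"
  shows
    "(cocommutative_algebra sA \<Delta> \<longrightarrow>
       (\<forall>T V0 B0.
          grouplike sA \<Delta> T \<and>
          complementary sA (module.span sA {T}) V0 UNIV \<and>
          \<Delta> ` V0 \<subseteq> subtensor sA sA V0 V0 \<and>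
          \<not> module.dependent sA B0 \<and> module.span sA B0 = V0 \<and>
          jacobi sA sV act \<Delta> \<kappa> \<longrightarrow>
          reflection_condition sV (act T) (kappa_coeff sA sV \<kappa> (insert T B0) T))) \<and>
     (\<forall>G.
        grouplike_algebra sA \<Delta> G \<and>
        (\<forall>T\<in>G. reflection_condition sV (act T) (kappa_coeff sA sV \<kappa> G T)) \<longrightarrow>
        jacobi sA sV act \<Delta> \<kappa>)"
proof -
  interpret M: algebra_module sA sV act by (fact V_module)
  have data: "jacobi_data sA sV act \<Delta> \<kappa> B"
    if "algebra_coproduct sA \<Delta>" "M.A.independent B" "M.A.span B = UNIV" for B
  proof -
    interpret algebra_coproduct sA \<Delta> by fact
    show ?thesis
      using kappa_linear that by unfold_locales
  qed
  show ?thesis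
  proof (intro conjI impI allI; (elim conjE)?)
    fix T V0 B0
    assume coc: "cocommutative_algebra sA \<Delta>" and T: "grouplike sA \<Delta> T"
      and compl: "complementary sA (M.A.span {T}) V0 UNIV"
      and V0: "\<Delta> ` V0 \<subseteq> subtensor sA sA V0 V0"
      and B0: "M.A.independent B0" "M.A.span B0 = V0" and J: "jacobi sA sV act \<Delta> \<kappa>"
    have "T \<in> M.A.span {T}" by (rule M.A.span_base) simp
    then have "T \<notin> V0"
      using compl T by (auto simp: complementary_def grouplike_def)
    then have "T \<notin> B0" using B0 M.A.span_base by blast
    have "M.A.independent (insert T B0)"
      using \<open>T \<notin> V0\<close> B0 by (simp add: M.A.independent_insertI)
    moreover have "M.A.span (insert T B0) = UNIV"
      using compl B0 unfolding complementary_def M.A.span_Un[of "{T}" B0, simplified] by auto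
    ultimately interpret jacobi_data sA sV act \<Delta> \<kappa> "insert T B0"
      using coc cocommutative_algebra.axioms(1) by (intro data) auto
    have "splits_off T"
      unfolding splits_off_def
    proof (intro conjI ballI)
      show "\<Delta> T = pure_tensor sA sA T T" using T by (simp add: grouplike_def)
      fix b assume "b \<in> insert T B0 - {T}"
      then have "\<Delta> b \<in> subtensor sA sA V0 V0" using B0 V0 M.A.span_base by blast
      then show "\<exists>x. \<Delta> b = tensor_class sA sA x \<and>
          Poly_Mapping.keys x \<subseteq> UNIV \<times> M.A.span (insert T B0 - {T})"
        using \<open>T \<notin> B0\<close> B0 by (auto simp: subtensor_def)
    qed simp
    then show "reflection_condition sV (act T) (kappa_coeff sA sV \<kappa> (insert T B0) T)"
      using J by (rule reflection_condition_if_jacobi)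
  next
    fix G
    assume G: "grouplike_algebra sA \<Delta> G"
      and refl: "\<forall>T\<in>G. reflection_condition sV (act T) (kappa_coeff sA sV \<kappa> G T)"
    interpret G: grouplike_algebra sA \<Delta> G by fact
    interpret jacobi_data sA sV act \<Delta> \<kappa> G
      by (intro data G.algebra_coproduct_axioms G.basis_independent G.basis_span)
    have "splits_off T" if "T \<in> G" for T
      unfolding splits_off_def
    proof (intro conjI ballI)
      fix b assume "b \<in> G - {T}"
      then show "\<exists>x. \<Delta> b = tensor_class sA sA x \<and>
          Poly_Mapping.keys x \<subseteq> UNIV \<times> M.A.span (G - {T})"
        using G.coproduct_basis[of b] M.A.span_base[of b "G - {T}"]
        by (intro exI[of _ "gen (b, b)"]) (simp add: pure_tensor_def keys_gen)
    qed (use that G.coproduct_basis in simp_all)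
    then show "jacobi sA sV act \<Delta> \<kappa>"
      using refl by (intro jacobi_if_reflection_conditions) auto
  qed
qed

end
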